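(* Let $\beta,\gamma\in(0,1)$, let the supply and demand assumptions in the context hold, and let $p_L<p_H\le p_{\rm bal}$. Then $(H,H)$ is the unique Nash equilibrium of the revenue competition game.
   Context: Supply and demand assumptions. $w(p)>0$ (supply) and $c(p)>0$ (demand) are real-valued functions of the price $p>0$; $c$ is strictly decreasing, $w$ is strictly increasing; $0<p_L<p_H$; there is a unique price $p_{\rm bal}$ with $w(\gamma p_{\rm bal})=c(p_{\rm bal})$. Revenue game. Two platforms simultaneously choose a strategy in $\{L,H\}$, i.e. a price $p_1$ (Platform 1), $p_2$ (Platform 2) in $\{p_L,p_H\}$. Given $(p_1,p_2)$, the throughput of Platform 1 is $$N_1(p_1,p_2)=\min\Big\{w(\gamma p_1),\tfrac{\beta}{1-\beta}w(\gamma p_2),c(p_1),\tfrac{\beta}{1-\beta}c(p_2),\beta c(\min\{p_1,p_2\}),\beta w(\max\{\gamma p_1,\gamma p_2\})\Big\}$$ and the throughput of Platform 2 is $N_2(p_1,p_2)=\frac{1-\beta}{\beta}N_1(p_1,p_2)$. (These are the numbers of matched worker–customer pairs at the two platforms in the aggregate-utility-maximizing allocation of users under customer loyalty $\beta$.) The payoff of Platform $i$ is its revenue $(1-\gamma)\,p_i\,N_i(p_1,p_2)$. Nash equilibrium means pure strategy Nash equilibrium: a pair of strategies from which no platform can strictly increase its payoff by a unilateral change of strategy. *)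

theory Defs
  imports Complex_Main
begin

datatype strategy = Low | High

fun price :: "real \<Rightarrow> real \<Rightarrow> strategy \<Rightarrow> real" where
  "price pL pH Low = pL"
| "price pL pH High = pH"

text \<open>
  The supply function \<open>w\<close> and the demand function \<open>c\<close> are total functions on the reals, but only
  their values at positive arguments are constrained and used. The balance price is the unique
  positive price at which supply, evaluated at the worker's share \<open>\<gamma> * p\<close>, meets demand.
\<close>

definition supply_demand :: "(real \<Rightarrow> real) \<Rightarrow> (real \<Rightarrow> real) \<Rightarrow> real \<Rightarrow> real \<Rightarrow> bool" where
  "supply_demand w c \<gamma> pbal \<longleftrightarrow>
     (\<forall>p>0. w p > 0) \<and> (\<forall>p>0. c p > 0) \<and>
     strict_mono_on {0<..} w \<and> strict_antimono_on {0<..} c \<and>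
     pbal > 0 \<and> w (\<gamma> * pbal) = c pbal \<and>
     (\<forall>p>0. w (\<gamma> * p) = c p \<longrightarrow> p = pbal)"

text \<open>
  Numbers of matched worker-customer pairs at the two platforms charging \<open>p1\<close> and \<open>p2\<close>, in the
  allocation of users that maximizes aggregate utility under customer loyalty \<open>\<beta>\<close>. This closed
  form is taken as the definition. A platform earns the commission \<open>(1 - \<gamma>)\<close> of the price on
  each matched pair.
\<close>

definition throughput1 ::
  "(real \<Rightarrow> real) \<Rightarrow> (real \<Rightarrow> real) \<Rightarrow> real \<Rightarrow> real \<Rightarrow> real \<Rightarrow> real \<Rightarrow> real" where
  "throughput1 w c \<beta> \<gamma> p1 p2 =
     Min {w (\<gamma> * p1), \<beta> / (1 - \<beta>) * w (\<gamma> * p2),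
          c p1, \<beta> / (1 - \<beta>) * c p2,
          \<beta> * c (min p1 p2), \<beta> * w (max (\<gamma> * p1) (\<gamma> * p2))}"

definition throughput2 ::
  "(real \<Rightarrow> real) \<Rightarrow> (real \<Rightarrow> real) \<Rightarrow> real \<Rightarrow> real \<Rightarrow> real \<Rightarrow> real \<Rightarrow> real" where
  "throughput2 w c \<beta> \<gamma> p1 p2 = (1 - \<beta>) / \<beta> * throughput1 w c \<beta> \<gamma> p1 p2"

definition revenue1 ::
  "(real \<Rightarrow> real) \<Rightarrow> (real \<Rightarrow> real) \<Rightarrow> real \<Rightarrow> real \<Rightarrow> real \<Rightarrow> real \<Rightarrow> strategy \<Rightarrow> strategy \<Rightarrow> real" where
  "revenue1 w c \<beta> \<gamma> pL pH s1 s2 =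
     (1 - \<gamma>) * price pL pH s1 * throughput1 w c \<beta> \<gamma> (price pL pH s1) (price pL pH s2)"

definition revenue2 ::
  "(real \<Rightarrow> real) \<Rightarrow> (real \<Rightarrow> real) \<Rightarrow> real \<Rightarrow> real \<Rightarrow> real \<Rightarrow> real \<Rightarrow> strategy \<Rightarrow> strategy \<Rightarrow> real" where
  "revenue2 w c \<beta> \<gamma> pL pH s1 s2 =
     (1 - \<gamma>) * price pL pH s2 * throughput2 w c \<beta> \<gamma> (price pL pH s1) (price pL pH s2)"

definition nash_equilibrium ::
  "('s \<Rightarrow> 't \<Rightarrow> real) \<Rightarrow> ('s \<Rightarrow> 't \<Rightarrow> real) \<Rightarrow> 's \<times> 't \<Rightarrow> bool" where
  "nash_equilibrium u1 u2 = (\<lambda>(s1, s2).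
     \<not> (\<exists>t1. u1 t1 s2 > u1 s1 s2) \<and> \<not> (\<exists>t2. u2 s1 t2 > u2 s1 s2))"

end

theory Submission
  imports Defs
begin

text \<open>
  At prices up to the balance price supply is the scarce side of the market: since \<open>w\<close> increases
  and \<open>c\<close> decreases, \<open>w (\<gamma> * p) \<le> w (\<gamma> * pbal) = c pbal \<le> c q\<close> whenever \<open>p, q \<le> pbal\<close>. The three
  demand terms in the throughput formula then never attain the minimum alone, and the throughput
  becomes a minimum of increasing functions of the two prices (\<open>throughput1_supply_limited\<close>).
  Raising its price therefore never costs a platform a matched pair, whatever the other platform
  does, and earns strictly more on each pair. So \<open>High\<close> strictly dominates \<open>Low\<close> for both
  platforms, and a profile of strictly dominant strategies is the only Nash equilibrium
  (\<open>nash_equilibrium_iff_strictly_dominant\<close>).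
\<close>

lemma nash_equilibrium_iff_strictly_dominant:
  assumes dom1: "\<And>s t. s \<noteq> s\<^sub>0 \<Longrightarrow> u1 s t < u1 s\<^sub>0 t"
    and dom2: "\<And>s t. t \<noteq> t\<^sub>0 \<Longrightarrow> u2 s t < u2 s t\<^sub>0"
  shows "nash_equilibrium u1 u2 st \<longleftrightarrow> st = (s\<^sub>0, t\<^sub>0)"
proof
  assume "nash_equilibrium u1 u2 st"
  then show "st = (s\<^sub>0, t\<^sub>0)"
    using dom1 dom2 unfolding nash_equilibrium_def by (cases st) fastforce
next
  assume "st = (s\<^sub>0, t\<^sub>0)"
  moreover have "u1 s t\<^sub>0 \<le> u1 s\<^sub>0 t\<^sub>0" for s
    using dom1[of s t\<^sub>0] by (cases "s = s\<^sub>0") auto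
  moreover have "u2 s\<^sub>0 t \<le> u2 s\<^sub>0 t\<^sub>0" for t
    using dom2[of t s\<^sub>0] by (cases "t = t\<^sub>0") auto
  ultimately show "nash_equilibrium u1 u2 st"
    unfolding nash_equilibrium_def by (simp add: not_less)
qed

lemma supply_le_demand_below_balance:
  assumes "supply_demand w c \<gamma> pbal" "0 < \<gamma>"
    and "0 < p" "p \<le> pbal" "0 < q" "q \<le> pbal"
  shows "w (\<gamma> * p) \<le> c q"
proof -
  from assms(1) have w: "strict_mono_on {0<..} w" and c: "strict_antimono_on {0<..} c"
    and bal: "0 < pbal" "w (\<gamma> * pbal) = c pbal"
    by (simp_all add: supply_demand_def)
  have "w (\<gamma> * p) \<le> w (\<gamma> * pbal)"
    using assms bal by (intro mono_onD[OF strict_mono_on_imp_mono_on[OF w]]) auto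
  also have "\<dots> = c pbal" by (fact bal)
  also have "\<dots> \<le> c q"
    using assms bal monotone_onD[OF c, of q pbal] by (cases "q = pbal") auto
  finally show ?thesis .
qed

text \<open>
  Each of the three demand terms carries a coefficient \<open>1\<close>, \<open>\<beta> / (1 - \<beta>)\<close> or \<open>\<beta>\<close>, none of which is
  below \<open>\<beta>\<close>, and each of the demands is at least the supply at the higher price. So these terms are
  already bounded below by the supply term \<open>\<beta> * w (\<gamma> * max p1 p2)\<close> and drop out of the minimum.
\<close>

lemma throughput1_supply_limited:
  assumes "0 < \<beta>" "\<beta> < 1" "0 < \<gamma>" "supply_demand w c \<gamma> pbal"
    and "0 < p1" "p1 \<le> pbal" "0 < p2" "p2 \<le> pbal"
  shows "throughput1 w c \<beta> \<gamma> p1 p2 =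
    min (\<beta> * w (\<gamma> * max p1 p2)) (min (w (\<gamma> * p1)) (\<beta> / (1 - \<beta>) * w (\<gamma> * p2)))"
proof -
  let ?W = "w (\<gamma> * max p1 p2)" and ?r = "\<beta> / (1 - \<beta>)"
  have supply_le_demand: "?W \<le> c q" if "0 < q" "q \<le> pbal" for q
    using assms that by (intro supply_le_demand_below_balance) auto
  have "0 < ?W"
    using assms by (simp add: supply_demand_def)
  moreover have "\<beta> \<le> ?r"
    using assms by (simp add: field_simps)
  ultimately have demand: "\<beta> * ?W \<le> c p1" "\<beta> * ?W \<le> ?r * c p2" "\<beta> * ?W \<le> \<beta> * c (min p1 p2)"
    using assms supply_le_demand[of p1] supply_le_demand[of p2] supply_le_demand[of "min p1 p2"]
      mult_mono[of \<beta> 1 ?W "c p1"] mult_mono[of \<beta> ?r ?W "c p2"]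
    by (simp_all add: min_less_iff_disj)
  have max: "max (\<gamma> * p1) (\<gamma> * p2) = \<gamma> * max p1 p2"
    using assms by (simp add: max_mult_distrib_left)
  define m where "m = min (\<beta> * ?W) (min (w (\<gamma> * p1)) (?r * w (\<gamma> * p2)))"
  have "m \<le> \<beta> * ?W" "m \<le> w (\<gamma> * p1)" "m \<le> ?r * w (\<gamma> * p2)"
    by (simp_all add: m_def)
  moreover have "m \<in> {\<beta> * ?W, w (\<gamma> * p1), ?r * w (\<gamma> * p2)}"
    by (simp add: m_def min_def)
  ultimately have "throughput1 w c \<beta> \<gamma> p1 p2 = m"
    unfolding throughput1_def max using demand by (intro Min_eqI) fastforce+
  then show ?thesis
    by (simp only: m_def)
qed

lemma throughput1_pos:
  assumes "0 < \<beta>" "\<beta> < 1" "0 < \<gamma>" "supply_demand w c \<gamma> pbal"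
    and "0 < p1" "0 < p2"
  shows "0 < throughput1 w c \<beta> \<gamma> p1 p2"
  using assms by (simp add: throughput1_def supply_demand_def less_max_iff_disj)

text \<open>
  Beyond the balance price this fails: there the decreasing demand terms can be the smallest ones.
\<close>

lemma throughput1_mono:
  assumes "0 < \<beta>" "\<beta> < 1" "0 < \<gamma>" "supply_demand w c \<gamma> pbal"
    and "0 < p1" "p1 \<le> q1" "q1 \<le> pbal" "0 < p2" "p2 \<le> q2" "q2 \<le> pbal"
  shows "throughput1 w c \<beta> \<gamma> p1 p2 \<le> throughput1 w c \<beta> \<gamma> q1 q2"
proof -
  have w: "strict_mono_on {0<..} w"
    using assms by (simp add: supply_demand_def)
  have mono: "w (\<gamma> * p) \<le> w (\<gamma> * q)" if "0 < p" "p \<le> q" for p q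
    using assms that by (intro mono_onD[OF strict_mono_on_imp_mono_on[OF w]]) auto
  have "min (\<beta> * w (\<gamma> * max p1 p2)) (min (w (\<gamma> * p1)) (\<beta> / (1 - \<beta>) * w (\<gamma> * p2)))
      \<le> min (\<beta> * w (\<gamma> * max q1 q2)) (min (w (\<gamma> * q1)) (\<beta> / (1 - \<beta>) * w (\<gamma> * q2)))"
    using assms by (intro min.mono mult_left_mono mono max.mono) auto
  moreover have "0 < q1" "p1 \<le> pbal" "0 < q2" "p2 \<le> pbal"
    using assms by auto
  ultimately show ?thesis
    using assms by (simp only: throughput1_supply_limited)
qed

theorem theorem6:
  fixes w c :: "real \<Rightarrow> real" and \<beta> \<gamma> pL pH pbal :: real
  assumes "0 < \<beta>" "\<beta> < 1" and "0 < \<gamma>" "\<gamma> < 1"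
    and "supply_demand w c \<gamma> pbal"
    and "0 < pL" "pL < pH" "pH \<le> pbal"
  shows "\<forall>s. nash_equilibrium (revenue1 w c \<beta> \<gamma> pL pH) (revenue2 w c \<beta> \<gamma> pL pH) s
             \<longleftrightarrow> s = (High, High)"
proof (intro allI nash_equilibrium_iff_strictly_dominant)
  have price: "0 < price pL pH s" "price pL pH s \<le> pbal" for s
    using assms by (cases s; simp)+
  note game = assms(1-3,5)
  fix s t :: strategy
  let ?N = "\<lambda>s t. throughput1 w c \<beta> \<gamma> (price pL pH s) (price pL pH t)"
  have pos: "0 < ?N s t"
    using price by (intro throughput1_pos[OF game])
  {
    assume "s \<noteq> High"
    then have s: "s = Low" by (cases s) auto
    have "?N Low t \<le> ?N High t"
      using assms price by (intro throughput1_mono[OF game]) auto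
    then have "pL * ?N Low t < pH * ?N High t"
      using assms pos s by (intro mult_less_le_imp_less) auto
    then show "revenue1 w c \<beta> \<gamma> pL pH s t < revenue1 w c \<beta> \<gamma> pL pH High t"
      using assms s by (simp add: revenue1_def)
  next
    assume "t \<noteq> High"
    then have t: "t = Low" by (cases t) auto
    have "?N s Low \<le> ?N s High"
      using assms price by (intro throughput1_mono[OF game]) auto
    then have "pL * ?N s Low < pH * ?N s High"
      using assms pos t by (intro mult_less_le_imp_less) auto
    then have "((1 - \<gamma>) * ((1 - \<beta>) / \<beta>)) * (pL * ?N s Low)
        < ((1 - \<gamma>) * ((1 - \<beta>) / \<beta>)) * (pH * ?N s High)"
      using assms by (intro mult_strict_left_mono) auto
    then show "revenue2 w c \<beta> \<gamma> pL pH s t < revenue2 w c \<beta> \<gamma> pL pH s High"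
      using t by (simp add: revenue2_def throughput2_def mult_ac)
  }
qed

end
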